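(* Let $\mathbb F=\mathbb Z_{\max}$. (i) Let $(X,\theta)$ be an archimedean set and $E=(X,\theta)^\vee$ the associated semimodule over $\mathbb F$. Let $E^*=(X',\theta^{-1})^\vee$, where $X'$ is the set $X$ endowed with the opposite order. Then $$\langle x,y\rangle_{\mathbb F}:=\inf\{v\in\mathbb F\mid x\le vy\}\qquad (x,y\in E,\ y\ne0)$$ (where $vy$ is computed in $E$, and the pairing is $0$ when the second argument is the zero of $E^*$) defines a bilinear pairing $E\times E^*\to\mathbb F$. (ii) Let $X=\mathbb Z$, $\theta(x)=x+n$ with $n\ge1$, and $E,E^*$ the associated semimodules over $\mathbb F$ as in (i). Then the pairing determines an isomorphism $$\ell:E^*\xrightarrow{\ \sim\ }\mathrm{Hom}_{\mathbb F}(E,\mathbb F),\qquad \ell_y(x):=\langle x,y\rangle_{\mathbb F}\quad\forall x\in E,\ y\in E^*.$$ (iii) The contravariant functor $\Lambda\to\Lambda$, $f\mapsto f^t$, is the inverse of transposition $f\mapsto f^*$, where for semimodules $E_1=(\mathbb Z,x\mapsto x+n)^\vee$ and $E_2=(\mathbb Z,x\mapsto x+m)^\vee$ the transposition $$\mathrm{Hom}_{\mathbb F}(E_1,E_2)\ni f\mapsto f^*\in\mathrm{Hom}_{\mathbb F}(E_2^*,E_1^* )$$ is defined by $\langle f(x),y\rangle_{\mathbb F}=\langle x,f^*(y)\rangle_{\mathbb F}$ for all $x\in E_1$, $y\in E_2^*$.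
   Context: An archimedean set is a pair $(X,\theta)$ of a non-empty totally ordered set $X$ and an order automorphism $\theta$ of $X$ with $\theta(x)>x$ for all $x$, such that for all $x,y\in X$ there is $n\in\mathbb N$ with $y\le\theta^n(x)$. $\mathbb F=\mathbb Z_{\max}=(\mathbb Z\cup\{-\infty\},\max,+)$ is written multiplicatively: its elements are $0$ and $u^n$, $n\in\mathbb Z$, with addition $u^n\vee u^m=u^{\max(n,m)}$, $0$ neutral for addition, and $u^nu^m=u^{n+m}$; it is totally ordered with $0$ smallest and $u^n\le u^m$ iff $n\le m$. A semimodule over $\mathbb F$ is a commutative monoid $(E,+)$ with identity $0$ and an $\mathbb F$-action with $\lambda(x+y)=\lambda x+\lambda y$, $(\lambda+\mu)x=\lambda x+\mu x$, $(\lambda\mu)x=\lambda(\mu x)$, $0x=0$, $1x=x$. $(X,\theta)^\vee$ is the semimodule $X\cup\{0\}$ over $\mathbb F$ with addition $x\vee y=\sup(x,y)$ for $x,y\in X$, $0\vee x=x\vee 0=x$, and action $u^nx=\theta^n(x)$ for $x\in X$, $0x=0$, $\lambda 0=0$; it is totally ordered with $0$ as smallest element. $\mathrm{Hom}_{\mathbb F}$ denotes $\mathbb F$-linear maps. Bilinear means $\mathbb F$-linear in each argument. Cyclic category $\Lambda$: objects $[n]$, $n\ge0$; morphisms $[n]\to[m]$ are classes of non-decreasing maps $f:\mathbb Z\to\mathbb Z$ with $f(x+n+1)=f(x)+m+1$, modulo adding constant multiples of $m+1$; equivalently, projective classes (modulo multiplication by non-zero elements of $\mathbb F$) of $\mathbb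 F$-linear maps $(\mathbb Z,x\mapsto x+n+1)^\vee\to(\mathbb Z,x\mapsto x+m+1)^\vee$ with $f^{-1}(\{0\})=\{0\}$. The functor $f\mapsto f^t$ is determined by $f(x)\ge y\iff x\ge f^t(y)$ for all $x,y\in\mathbb Z$. For $f$ with $f^{-1}(\{0\})=\{0\}$, the map $f^*:E_2^*\to E_1^*$ restricts to a map between the underlying sets $\mathbb Z$ of non-zero elements, and in this way is viewed as representing a morphism of $\Lambda$ in the opposite direction to $f$. *)

theory Defs
  imports Main "HOL-Library.FuncSet"
begin

section \<open>The semifield \<open>\<int>\<^sub>m\<^sub>a\<^sub>x\<close>\<close>

text \<open>\<open>U n\<close> is the element written \<open>u\<close> to the power \<open>n\<close>; the addition is the supremum and the
  multiplication adds exponents.\<close>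

datatype zmax = Zero | U int

instantiation zmax :: linorder
begin

fun less_eq_zmax :: "zmax \<Rightarrow> zmax \<Rightarrow> bool" where
  "less_eq_zmax Zero y = True"
| "less_eq_zmax (U m) Zero = False"
| "less_eq_zmax (U m) (U n) = (m \<le> n)"

definition less_zmax :: "zmax \<Rightarrow> zmax \<Rightarrow> bool" where
  "less_zmax x y \<longleftrightarrow> x \<le> y \<and> \<not> y \<le> x"

instance
proof
  fix x y z :: zmax
  show "x < y \<longleftrightarrow> x \<le> y \<and> \<not> y \<le> x" by (rule less_zmax_def)
  show "x \<le> x" by (cases x) auto
  show "x \<le> y \<Longrightarrow> y \<le> z \<Longrightarrow> x \<le> z" by (cases x; cases y; cases z) auto
  show "x \<le> y \<Longrightarrow> y \<le> x \<Longrightarrow> x = y" by (cases x; cases y) auto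
  show "x \<le> y \<or> y \<le> x" by (cases x; cases y) auto
qed

end

instantiation zmax :: order_bot
begin

definition bot_zmax :: zmax where "bot_zmax = Zero"

instance by standard (simp add: bot_zmax_def)

end

instantiation zmax :: comm_semiring_1
begin

definition zero_zmax :: zmax where "zero_zmax = Zero"

definition one_zmax :: zmax where "one_zmax = U 0"

definition plus_zmax :: "zmax \<Rightarrow> zmax \<Rightarrow> zmax" where "plus_zmax x y = max x y"

fun times_zmax :: "zmax \<Rightarrow> zmax \<Rightarrow> zmax" where
  "times_zmax Zero y = Zero"
| "times_zmax (U m) Zero = Zero"
| "times_zmax (U m) (U n) = U (m + n)"

instance
proof
  fix x y z :: zmax
  show "x * y * z = x * (y * z)" by (cases x; cases y; cases z) auto
  show "x * y = y * x" by (cases x; cases y) auto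
  show "1 * x = x" by (cases x) (auto simp: one_zmax_def)
  show "x + y + z = x + (y + z)" by (simp add: plus_zmax_def max.assoc)
  show "x + y = y + x" by (simp add: plus_zmax_def max.commute)
  show "0 + x = x" by (simp add: plus_zmax_def zero_zmax_def max_def)
  show "(x + y) * z = x * z + y * z"
    by (cases x; cases y; cases z) (auto simp: plus_zmax_def max_def)
  show "0 * x = 0" by (simp add: zero_zmax_def)
  show "x * 0 = 0" by (cases x) (auto simp: zero_zmax_def)
  show "(0::zmax) \<noteq> 1" by (simp add: zero_zmax_def one_zmax_def)
qed

end

lemma zmax_bounded_has_greatest:
  fixes L :: "zmax set"
  assumes "L \<noteq> {}" and "\<And>x. x \<in> L \<Longrightarrow> x \<le> b"
  shows "\<exists>m\<in>L. \<forall>x\<in>L. x \<le> m"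
proof (cases "\<exists>a. U a \<in> L")
  case False
  then have "x = Zero" if "x \<in> L" for x using that by (cases x) auto
  then show ?thesis using assms(1) by auto
next
  case True
  then obtain a where a: "U a \<in> L" by blast
  with assms(2) obtain c where c: "b = U c" by (cases b) fastforce+
  have le: "n \<le> c" if "U n \<in> L" for n using assms(2)[OF that] c by simp
  let ?P = "\<lambda>k::nat. U (c - int k) \<in> L"
  have "?P (nat (c - a))" using le[OF a] a by simp
  then have 1: "?P (Least ?P)" by (rule LeastI)
  have "x \<le> U (c - int (Least ?P))" if "x \<in> L" for x
  proof (cases x)
    case (U n)
    then have "?P (nat (c - n))" using le[of n] that by simp
    then have "Least ?P \<le> nat (c - n)" by (rule Least_le)
    then show ?thesis using le[of n] that U by simp
  qed simp
  with 1 show ?thesis by blast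
qed

lemma zmax_has_least:
  fixes L :: "zmax set"
  assumes "L \<noteq> {}" and "\<And>x. x \<in> L \<Longrightarrow> U b \<le> x"
  shows "\<exists>m\<in>L. \<forall>x\<in>L. m \<le> x"
proof -
  let ?neg = "\<lambda>x. case x of Zero \<Rightarrow> Zero | U n \<Rightarrow> U (- n)"
  have "\<exists>m\<in>?neg ` L. \<forall>x\<in>?neg ` L. x \<le> m"
  proof (rule zmax_bounded_has_greatest)
    show "?neg ` L \<noteq> {}" using assms(1) by simp
    fix x assume "x \<in> ?neg ` L"
    then show "x \<le> U (- b)" using assms(2) by (force split: zmax.splits)
  qed
  then obtain m where m: "m \<in> L" "\<And>x. x \<in> L \<Longrightarrow> ?neg x \<le> ?neg m" by blast
  have "m \<le> x" if "x \<in> L" for x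
    using m(2)[OF that] assms(2)[OF that] assms(2)[OF m(1)] by (cases m; cases x) auto
  with m(1) show ?thesis by blast
qed

text \<open>Every non-empty subset of \<open>\<int>\<^sub>m\<^sub>a\<^sub>x\<close> has an infimum, every bounded one a supremum;
  the empty set has no infimum (there is no largest element).\<close>

instantiation zmax :: conditionally_complete_linorder
begin

definition inf_zmax :: "zmax \<Rightarrow> zmax \<Rightarrow> zmax" where "inf_zmax = min"

definition sup_zmax :: "zmax \<Rightarrow> zmax \<Rightarrow> zmax" where "sup_zmax = max"

definition Inf_zmax :: "zmax set \<Rightarrow> zmax" where
  "Inf_zmax S = (GREATEST m. \<forall>v\<in>S. m \<le> v)"

definition Sup_zmax :: "zmax set \<Rightarrow> zmax" where
  "Sup_zmax S = (LEAST m. \<forall>v\<in>S. v \<le> m)"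

instance
proof
  fix x y z :: zmax and X :: "zmax set"
  show "inf x y \<le> x" "inf x y \<le> y" by (simp_all add: inf_zmax_def)
  show "x \<le> y \<Longrightarrow> x \<le> z \<Longrightarrow> x \<le> inf y z" by (simp add: inf_zmax_def)
  show "x \<le> sup x y" "y \<le> sup x y" by (simp_all add: sup_zmax_def)
  show "y \<le> x \<Longrightarrow> z \<le> x \<Longrightarrow> sup y z \<le> x" by (simp add: sup_zmax_def)
  have Inf: "(\<forall>v\<in>X. Inf X \<le> v) \<and> (\<forall>w. (\<forall>v\<in>X. w \<le> v) \<longrightarrow> w \<le> Inf X)" if "X \<noteq> {}"
  proof -
    have "\<exists>m\<in>{m. \<forall>v\<in>X. m \<le> v}. \<forall>w\<in>{m. \<forall>v\<in>X. m \<le> v}. w \<le> m"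
    proof (rule zmax_bounded_has_greatest)
      show "{m. \<forall>v\<in>X. m \<le> v} \<noteq> {}" using less_eq_zmax.simps(1) by blast
      show "w \<le> (SOME v. v \<in> X)" if "w \<in> {m. \<forall>v\<in>X. m \<le> v}" for w
        using that \<open>X \<noteq> {}\<close> by (simp add: some_in_eq)
    qed
    then obtain m where m: "\<forall>v\<in>X. m \<le> v" "\<And>w. \<forall>v\<in>X. w \<le> v \<Longrightarrow> w \<le> m" by blast
    then have "Inf X = m" unfolding Inf_zmax_def by (intro Greatest_equality) auto
    with m show ?thesis by auto
  qed
  show "x \<in> X \<Longrightarrow> bdd_below X \<Longrightarrow> Inf X \<le> x" using Inf by blast
  show "X \<noteq> {} \<Longrightarrow> (\<And>x. x \<in> X \<Longrightarrow> z \<le> x) \<Longrightarrow> z \<le> Inf X" using Inf by blast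
  have Sup: "(\<forall>v\<in>X. v \<le> Sup X) \<and> (\<forall>w. (\<forall>v\<in>X. v \<le> w) \<longrightarrow> Sup X \<le> w)" if "bdd_above X"
  proof -
    have "\<exists>m\<in>{m. \<forall>v\<in>X. v \<le> m}. \<forall>w\<in>{m. \<forall>v\<in>X. v \<le> m}. m \<le> w"
    proof (cases "\<exists>b. U b \<in> X")
      case True
      then obtain b where "U b \<in> X" by blast
      then show ?thesis using that by (intro zmax_has_least[of _ b]) (auto simp: bdd_above_def)
    next
      case False
      then have "v = Zero" if "v \<in> X" for v using that by (cases v) auto
      then show ?thesis by (intro bexI[of _ Zero]) auto
    qed
    then obtain m where m: "\<forall>v\<in>X. v \<le> m" "\<And>w. \<forall>v\<in>X. v \<le> w \<Longrightarrow> m \<le> w" by blast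
    then have "Sup X = m" unfolding Sup_zmax_def by (intro Least_equality) auto
    with m show ?thesis by auto
  qed
  show "x \<in> X \<Longrightarrow> bdd_above X \<Longrightarrow> x \<le> Sup X" using Sup by blast
  show "X \<noteq> {} \<Longrightarrow> (\<And>x. x \<in> X \<Longrightarrow> x \<le> z) \<Longrightarrow> Sup X \<le> z"
    using Sup by (meson bdd_above_def)
qed

end


section \<open>Semimodules over \<open>\<int>\<^sub>m\<^sub>a\<^sub>x\<close>\<close>

record 'e semimod =
  carrier :: "'e set"
  zero :: 'e
  add :: "'e \<Rightarrow> 'e \<Rightarrow> 'e"
  smult :: "zmax \<Rightarrow> 'e \<Rightarrow> 'e"

definition semimodule :: "'e semimod \<Rightarrow> bool" where
  "semimodule E \<longleftrightarrow>
     zero E \<in> carrier E \<and>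
     (\<forall>x\<in>carrier E. \<forall>y\<in>carrier E. add E x y \<in> carrier E) \<and>
     (\<forall>l. \<forall>x\<in>carrier E. smult E l x \<in> carrier E) \<and>
     (\<forall>x\<in>carrier E. \<forall>y\<in>carrier E. \<forall>z\<in>carrier E.
        add E (add E x y) z = add E x (add E y z)) \<and>
     (\<forall>x\<in>carrier E. \<forall>y\<in>carrier E. add E x y = add E y x) \<and>
     (\<forall>x\<in>carrier E. add E (zero E) x = x) \<and>
     (\<forall>l. \<forall>x\<in>carrier E. \<forall>y\<in>carrier E.
        smult E l (add E x y) = add E (smult E l x) (smult E l y)) \<and>
     (\<forall>l m. \<forall>x\<in>carrier E. smult E (l + m) x = add E (smult E l x) (smult E m x)) \<and>
     (\<forall>l m. \<forall>x\<in>carrier E. smult E (l * m) x = smult E l (smult E m x)) \<and>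
     (\<forall>x\<in>carrier E. smult E 0 x = zero E) \<and>
     (\<forall>x\<in>carrier E. smult E 1 x = x)"

definition zmax_semimod :: "zmax semimod" where
  "zmax_semimod = \<lparr>carrier = UNIV, zero = 0, add = (+), smult = (*)\<rparr>"

text \<open>Preservation of zero follows from homogeneity. The maps are extensional (arbitrary but fixed
  outside the carrier), so that equality of functions is equality of linear maps.\<close>

definition Hom :: "'e semimod \<Rightarrow> 'f semimod \<Rightarrow> ('e \<Rightarrow> 'f) set" where
  "Hom E M = {f \<in> carrier E \<rightarrow>\<^sub>E carrier M.
     (\<forall>x\<in>carrier E. \<forall>y\<in>carrier E. f (add E x y) = add M (f x) (f y)) \<and>
     (\<forall>l. \<forall>x\<in>carrier E. f (smult E l x) = smult M l (f x))}"

definition Hom_semimod :: "'e semimod \<Rightarrow> 'f semimod \<Rightarrow> ('e \<Rightarrow> 'f) semimod" where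
  "Hom_semimod E M = \<lparr>carrier = Hom E M,
     zero = (\<lambda>x\<in>carrier E. zero M),
     add = (\<lambda>f g. \<lambda>x\<in>carrier E. add M (f x) (g x)),
     smult = (\<lambda>l f. \<lambda>x\<in>carrier E. smult M l (f x))\<rparr>"

definition Iso :: "'e semimod \<Rightarrow> 'f semimod \<Rightarrow> ('e \<Rightarrow> 'f) set" where
  "Iso E M = {f \<in> Hom E M. bij_betw f (carrier E) (carrier M)}"

definition bilinear_map ::
  "'e semimod \<Rightarrow> 'f semimod \<Rightarrow> 'g semimod \<Rightarrow> ('e \<Rightarrow> 'f \<Rightarrow> 'g) \<Rightarrow> bool" where
  "bilinear_map E E' M p \<longleftrightarrow>
     (\<forall>y\<in>carrier E'. (\<lambda>x\<in>carrier E. p x y) \<in> Hom E M) \<and>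
     (\<forall>x\<in>carrier E. (\<lambda>y\<in>carrier E'. p x y) \<in> Hom E' M)"


section \<open>Archimedean sets and the associated semimodules\<close>

text \<open>\<open>(x, y) \<in> ord A\<close> means \<open>x \<le> y\<close>.\<close>

record 'a ordset_aut =
  pts :: "'a set"
  ord :: "'a rel"
  aut :: "'a \<Rightarrow> 'a"

definition archimedean_set :: "'a ordset_aut \<Rightarrow> bool" where
  "archimedean_set A \<longleftrightarrow>
     pts A \<noteq> {} \<and> linear_order_on (pts A) (ord A) \<and>
     bij_betw (aut A) (pts A) (pts A) \<and>
     (\<forall>x\<in>pts A. \<forall>y\<in>pts A. (aut A x, aut A y) \<in> ord A \<longleftrightarrow> (x, y) \<in> ord A) \<and>
     (\<forall>x\<in>pts A. (x, aut A x) \<in> ord A \<and> aut A x \<noteq> x) \<and>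
     (\<forall>x\<in>pts A. \<forall>y\<in>pts A. \<exists>n::nat. (y, (aut A ^^ n) x) \<in> ord A)"

definition aut_inv :: "'a ordset_aut \<Rightarrow> 'a \<Rightarrow> 'a" where
  "aut_inv A = inv_into (pts A) (aut A)"

definition aut_pow :: "'a ordset_aut \<Rightarrow> int \<Rightarrow> 'a \<Rightarrow> 'a" where
  "aut_pow A n x = (if 0 \<le> n then (aut A ^^ nat n) x else (aut_inv A ^^ nat (- n)) x)"

definition opp :: "'a ordset_aut \<Rightarrow> 'a ordset_aut" where
  "opp A = \<lparr>pts = pts A, ord = (ord A)\<inverse>, aut = aut_inv A\<rparr>"

text \<open>The semimodule \<open>(X, \<theta>)\<^sup>\<or>\<close>, with \<open>None\<close> as the adjoined zero element.\<close>

definition vee :: "'a ordset_aut \<Rightarrow> 'a option semimod" where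
  "vee A = \<lparr>carrier = insert None (Some ` pts A),
     zero = None,
     add = (\<lambda>x y. case (x, y) of
        (None, _) \<Rightarrow> y
      | (_, None) \<Rightarrow> x
      | (Some a, Some b) \<Rightarrow> Some (if (a, b) \<in> ord A then b else a)),
     smult = (\<lambda>l x. case (l, x) of
        (U n, Some a) \<Rightarrow> Some (aut_pow A n a)
      | _ \<Rightarrow> None)\<rparr>"

definition vee_le :: "'a ordset_aut \<Rightarrow> 'a option \<Rightarrow> 'a option \<Rightarrow> bool" where
  "vee_le A x y = (case (x, y) of
        (None, _) \<Rightarrow> True
      | (Some a, None) \<Rightarrow> False
      | (Some a, Some b) \<Rightarrow> (a, b) \<in> ord A)"

abbreviation vee_dual :: "'a ordset_aut \<Rightarrow> 'a option semimod" where
  "vee_dual A \<equiv> vee (opp A)"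

text \<open>In \<open>pairing A x y\<close> the argument \<open>y\<close> is an element of \<^term>\<open>vee_dual A\<close>, which has the same
  elements as \<^term>\<open>vee A\<close>; the multiple of \<open>y\<close> is formed in \<^term>\<open>vee A\<close>.\<close>

definition pairing :: "'a ordset_aut \<Rightarrow> 'a option \<Rightarrow> 'a option \<Rightarrow> zmax" where
  "pairing A x y =
     (if y = zero (vee_dual A) then 0 else Inf {v. vee_le A x (smult (vee A) v y)})"

definition is_transpose ::
  "'a ordset_aut \<Rightarrow> 'b ordset_aut \<Rightarrow> ('a option \<Rightarrow> 'b option) \<Rightarrow> ('b option \<Rightarrow> 'a option) \<Rightarrow> bool"
  where
  "is_transpose A B f g \<longleftrightarrow> g \<in> Hom (vee_dual B) (vee_dual A) \<and>
     (\<forall>x\<in>carrier (vee A). \<forall>y\<in>carrier (vee_dual B). pairing B (f x) y = pairing A x (g y))"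

definition Hom_transpose ::
  "'a ordset_aut \<Rightarrow> 'b ordset_aut \<Rightarrow> ('a option \<Rightarrow> 'b option) \<Rightarrow> 'b option \<Rightarrow> 'a option" where
  "Hom_transpose A B f = (THE g. is_transpose A B f g)"

definition zshift :: "nat \<Rightarrow> int ordset_aut" where
  "zshift n = \<lparr>pts = UNIV, ord = {(x, y). x \<le> y}, aut = (\<lambda>x. x + int n)\<rparr>"


section \<open>The cyclic category\<close>

text \<open>The natural number \<open>n\<close> stands for the object \<open>[n]\<close>. A morphism from \<open>[n]\<close> to \<open>[m]\<close> is
  an element of \<open>Lam n m\<close>, i.e. a class of maps. Under \<^term>\<open>map_option\<close> the maps are the
  linear maps with trivial kernel between the semimodules of \<open>zshift (n + 1)\<close> and
  \<open>zshift (m + 1)\<close>, and \<open>cyc_rel\<close> is proportionality: adding \<open>k * (m + 1)\<close> is multiplication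
  by \<^term>\<open>U k\<close>.\<close>

definition cyc_maps :: "nat \<Rightarrow> nat \<Rightarrow> (int \<Rightarrow> int) set" where
  "cyc_maps n m = {f. mono f \<and> (\<forall>x. f (x + int n + 1) = f x + int m + 1)}"

definition cyc_rel :: "nat \<Rightarrow> nat \<Rightarrow> (int \<Rightarrow> int) rel" where
  "cyc_rel n m = {(f, g). f \<in> cyc_maps n m \<and> g \<in> cyc_maps n m \<and>
     (\<exists>k. \<forall>x. g x = f x + k * (int m + 1))}"

definition Lam :: "nat \<Rightarrow> nat \<Rightarrow> (int \<Rightarrow> int) set set" where
  "Lam n m = cyc_maps n m // cyc_rel n m"

abbreviation cyc_class :: "nat \<Rightarrow> nat \<Rightarrow> (int \<Rightarrow> int) \<Rightarrow> (int \<Rightarrow> int) set" where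
  "cyc_class n m f \<equiv> cyc_rel n m `` {f}"

definition Lam_id :: "nat \<Rightarrow> (int \<Rightarrow> int) set" where
  "Lam_id n = cyc_class n n id"

text \<open>Operations on morphisms are defined on representatives; the union over all representatives
  is the common class of the results.\<close>

definition Lam_comp ::
  "nat \<Rightarrow> nat \<Rightarrow> nat \<Rightarrow> (int \<Rightarrow> int) set \<Rightarrow> (int \<Rightarrow> int) set \<Rightarrow> (int \<Rightarrow> int) set" where
  "Lam_comp n m k \<psi> \<phi> = (\<Union>g\<in>\<psi>. \<Union>f\<in>\<phi>. cyc_class n k (g \<circ> f))"

definition is_cyc_t :: "(int \<Rightarrow> int) \<Rightarrow> (int \<Rightarrow> int) \<Rightarrow> bool" where
  "is_cyc_t f g \<longleftrightarrow> (\<forall>x y. f x \<ge> y \<longleftrightarrow> x \<ge> g y)"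

definition cyc_t :: "(int \<Rightarrow> int) \<Rightarrow> int \<Rightarrow> int" where
  "cyc_t f = (THE g. is_cyc_t f g)"

definition Lam_t :: "nat \<Rightarrow> nat \<Rightarrow> (int \<Rightarrow> int) set \<Rightarrow> (int \<Rightarrow> int) set" where
  "Lam_t n m \<phi> = (\<Union>f\<in>\<phi>. cyc_class m n (cyc_t f))"

text \<open>A map \<open>f\<close> in \<open>cyc_maps n m\<close> is the restriction to non-zero elements of the linear map
  \<^term>\<open>map_option f\<close> (see \<open>cyc_maps_iff_Hom\<close> and \<open>Hom_zero_kernel\<close> below). Its transpose is
  restricted to non-zero elements in turn.\<close>

definition cyc_star :: "nat \<Rightarrow> nat \<Rightarrow> (int \<Rightarrow> int) \<Rightarrow> int \<Rightarrow> int" where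
  "cyc_star n m f y =
     the (Hom_transpose (zshift (n + 1)) (zshift (m + 1)) (map_option f) (Some y))"

definition Lam_star :: "nat \<Rightarrow> nat \<Rightarrow> (int \<Rightarrow> int) set \<Rightarrow> (int \<Rightarrow> int) set" where
  "Lam_star n m \<phi> = (\<Union>f\<in>\<phi>. cyc_class m n (cyc_star n m f))"


section \<open>The structures are as intended\<close>

lemma aut_inv:
  assumes "archimedean_set A"
  shows "x \<in> pts A \<Longrightarrow> aut_inv A x \<in> pts A"
    and "x \<in> pts A \<Longrightarrow> aut A (aut_inv A x) = x"
    and "x \<in> pts A \<Longrightarrow> aut_inv A (aut A x) = x"
    and "x \<in> pts A \<Longrightarrow> aut A x \<in> pts A"
  using assms unfolding archimedean_set_def aut_inv_def bij_betw_def
  by (auto simp: inv_into_into f_inv_into_f inv_into_f_f)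

lemma aut_funpow:
  assumes A: "archimedean_set A" and x: "x \<in> pts A"
  shows "(aut A ^^ n) x \<in> pts A" "(aut_inv A ^^ n) x \<in> pts A"
    "(aut A ^^ n) ((aut_inv A ^^ n) x) = x"
proof -
  have 1: "(aut A ^^ n) x \<in> pts A" "(aut_inv A ^^ n) x \<in> pts A" for n
    by (induction n) (auto simp: x aut_inv[OF A])
  then show "(aut A ^^ n) x \<in> pts A" "(aut_inv A ^^ n) x \<in> pts A" by auto
  show "(aut A ^^ n) ((aut_inv A ^^ n) x) = x"
  proof (induction n)
    case (Suc n)
    have "(aut A ^^ Suc n) ((aut_inv A ^^ Suc n) x)
        = (aut A ^^ n) (aut A (aut_inv A ((aut_inv A ^^ n) x)))"
      by (simp add: funpow_swap1)
    then show ?case using Suc 1 by (simp add: aut_inv[OF A])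
  qed simp
qed

lemma aut_funpow_ord:
  assumes A: "archimedean_set A" and "x \<in> pts A" "y \<in> pts A"
  shows "((aut A ^^ n) x, (aut A ^^ n) y) \<in> ord A \<longleftrightarrow> (x, y) \<in> ord A"
proof (induction n)
  case (Suc n)
  then show ?case using A aut_funpow(1)[OF A] assms(2,3)
    unfolding archimedean_set_def by simp
qed simp

lemma archimedean_set_opp:
  assumes A: "archimedean_set A"
  shows "archimedean_set (opp A)"
proof -
  note D = A[unfolded archimedean_set_def]
  have "bij_betw (aut_inv A) (pts A) (pts A)"
    using D unfolding aut_inv_def by (blast intro: bij_betw_inv_into)
  moreover have "(aut_inv A y, aut_inv A x) \<in> ord A \<longleftrightarrow> (y, x) \<in> ord A"
    if "x \<in> pts A" "y \<in> pts A" for x y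
    using D aut_inv[OF A] that by metis
  moreover have "(aut_inv A x, x) \<in> ord A \<and> aut_inv A x \<noteq> x" if "x \<in> pts A" for x
    using D aut_inv[OF A] that by metis
  moreover have "\<exists>n. ((aut_inv A ^^ n) x, y) \<in> ord A" if xy: "x \<in> pts A" "y \<in> pts A" for x y
  proof -
    obtain n where n: "(x, (aut A ^^ n) y) \<in> ord A" using D xy by blast
    then have "((aut A ^^ n) ((aut_inv A ^^ n) x), (aut A ^^ n) y) \<in> ord A"
      using aut_funpow(3)[OF A xy(1)] by simp
    then show ?thesis using aut_funpow_ord[OF A aut_funpow(2)[OF A xy(1)] xy(2)] by blast
  qed
  ultimately show ?thesis
    using D unfolding archimedean_set_def opp_def by simp
qed

lemma archimedean_set_zshift: "n \<ge> 1 \<Longrightarrow> archimedean_set (zshift n)"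
proof -
  assume n: "n \<ge> 1"
  have pow: "((\<lambda>x. x + int n) ^^ k) x = x + int k * int n" for k x
    by (induction k) (auto simp: algebra_simps)
  have "\<exists>k. y \<le> x + int k * int n" for x y
  proof
    have "y - x \<le> int (nat (y - x)) * 1" by simp
    also have "\<dots> \<le> int (nat (y - x)) * int n" using n by (intro mult_left_mono) auto
    finally show "y \<le> x + int (nat (y - x)) * int n" by simp
  qed
  moreover have "bij (\<lambda>x. x + int n)"
    by (rule bij_betwI[of _ _ _ "\<lambda>x. x - int n"]) auto
  moreover have "linear_order_on UNIV {(x, y::int). x \<le> y}"
    by (auto simp: linear_order_on_def partial_order_on_def preorder_on_def refl_on_def
        trans_def antisym_def total_on_def)
  ultimately show ?thesis using n unfolding archimedean_set_def zshift_def by (auto simp: pow)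
qed

lemma aut_pow_in: "archimedean_set A \<Longrightarrow> x \<in> pts A \<Longrightarrow> aut_pow A n x \<in> pts A"
  by (simp add: aut_pow_def aut_funpow)

lemma aut_pow_Suc:
  assumes A: "archimedean_set A" and x: "x \<in> pts A"
  shows "aut_pow A (n + 1) x = aut A (aut_pow A n x)"
proof (cases "n \<ge> 0")
  case True
  then have "nat (n + 1) = Suc (nat n)" by simp
  then show ?thesis using True by (simp add: aut_pow_def)
next
  case False
  then have "nat (- n) = Suc (nat (- (n + 1)))" by simp
  then have "aut_pow A n x = aut_inv A ((aut_inv A ^^ nat (- (n + 1))) x)"
    using False by (simp add: aut_pow_def)
  moreover have "aut_pow A (n + 1) x = (aut_inv A ^^ nat (- (n + 1))) x"
    using False by (cases "n = - 1") (auto simp: aut_pow_def)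
  ultimately show ?thesis using aut_inv(2)[OF A] aut_funpow(2)[OF A x] by simp
qed

lemma aut_pow_add:
  assumes A: "archimedean_set A" and x: "x \<in> pts A"
  shows "aut_pow A (m + n) x = aut_pow A m (aut_pow A n x)"
proof (induction m rule: int_induct[where k = 0])
  case base
  show ?case by (simp add: aut_pow_def)
next
  case (step1 i)
  have "aut_pow A (i + 1 + n) x = aut A (aut_pow A (i + n) x)"
    using aut_pow_Suc[OF A x, of "i + n"] by (simp add: algebra_simps)
  then show ?case using step1 aut_pow_Suc[OF A aut_pow_in[OF A x]] by simp
next
  case (step2 i)
  have "aut A (aut_pow A (i - 1 + n) x) = aut_pow A (i + n) x"
    using aut_pow_Suc[OF A x, of "i - 1 + n"] by (simp add: algebra_simps)
  moreover have "aut A (aut_pow A (i - 1) (aut_pow A n x)) = aut_pow A i (aut_pow A n x)"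
    using aut_pow_Suc[OF A aut_pow_in[OF A x], of "i - 1"] by simp
  ultimately have "aut A (aut_pow A (i - 1 + n) x) = aut A (aut_pow A (i - 1) (aut_pow A n x))"
    using step2 by simp
  then show ?case by (metis A aut_inv(3) aut_pow_in x)
qed

lemma aut_pow_ord:
  assumes A: "archimedean_set A" and xy: "x \<in> pts A" "y \<in> pts A"
  shows "(aut_pow A n x, aut_pow A n y) \<in> ord A \<longleftrightarrow> (x, y) \<in> ord A"
proof (cases "n \<ge> 0")
  case True
  then show ?thesis by (simp add: aut_pow_def aut_funpow_ord[OF A xy])
next
  case False
  then show ?thesis
    using aut_funpow_ord[OF A aut_funpow(2)[OF A xy(1), of "nat (- n)"]
        aut_funpow(2)[OF A xy(2), of "nat (- n)"], of "nat (- n)"]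
      aut_funpow(3)[OF A] xy by (simp add: aut_pow_def)
qed

lemma aut_pow_mono_exp:
  assumes A: "archimedean_set A" and x: "x \<in> pts A" and mn: "m \<le> n"
  shows "(aut_pow A m x, aut_pow A n x) \<in> ord A"
  using mn
proof (induction n rule: int_ge_induct)
  case base
  show ?case using A aut_pow_in[OF A x]
    by (auto simp: archimedean_set_def linear_order_on_def partial_order_on_def preorder_on_def
        refl_on_def)
next
  case (step n)
  have "(aut_pow A n x, aut_pow A (n + 1) x) \<in> ord A"
    using A aut_pow_in[OF A x] aut_pow_Suc[OF A x] by (simp add: archimedean_set_def)
  moreover have "trans (ord A)"
    using A by (auto simp: archimedean_set_def linear_order_on_def partial_order_on_def
        preorder_on_def)
  ultimately show ?case using step by (blast dest: transD)
qed

lemma semimodule_vee: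
  assumes A: "archimedean_set A"
  shows "semimodule (vee A)"
proof -
  have lo: "linear_order_on (pts A) (ord A)" using A by (simp add: archimedean_set_def)
  have refl: "(x, x) \<in> ord A" if "x \<in> pts A" for x
    using lo that
    by (auto simp: linear_order_on_def partial_order_on_def preorder_on_def refl_on_def)
  have trans: "(x, z) \<in> ord A" if "(x, y) \<in> ord A" "(y, z) \<in> ord A" for x y z
    using lo that unfolding linear_order_on_def partial_order_on_def preorder_on_def
    by (blast dest: transD)
  have antisym: "x = y" if "(x, y) \<in> ord A" "(y, x) \<in> ord A" for x y
    using lo that unfolding linear_order_on_def partial_order_on_def by (blast dest: antisymD)
  have total: "(x, y) \<in> ord A \<or> (y, x) \<in> ord A" if "x \<in> pts A" "y \<in> pts A" for x y
    using lo that refl unfolding linear_order_on_def total_on_def by (cases "x = y") auto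
  have exp: "(aut_pow A m x, aut_pow A n x) \<in> ord A \<longleftrightarrow> m \<le> n" if x: "x \<in> pts A" for m n x
  proof
    show "m \<le> n \<Longrightarrow> (aut_pow A m x, aut_pow A n x) \<in> ord A" by (rule aut_pow_mono_exp[OF A x])
    assume *: "(aut_pow A m x, aut_pow A n x) \<in> ord A"
    show "m \<le> n"
    proof (rule ccontr)
      assume "\<not> m \<le> n"
      then have "(aut_pow A (n + 1) x, aut_pow A m x) \<in> ord A"
        by (intro aut_pow_mono_exp[OF A x]) simp
      then have "(aut A (aut_pow A n x), aut_pow A n x) \<in> ord A"
        using * trans aut_pow_Suc[OF A x] by metis
      moreover have "(aut_pow A n x, aut A (aut_pow A n x)) \<in> ord A"
        "aut A (aut_pow A n x) \<noteq> aut_pow A n x"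
        using A aut_pow_in[OF A x] by (simp_all add: archimedean_set_def)
      ultimately show False using antisym by blast
    qed
  qed
  have in': "aut_pow A n x \<in> pts A" if "x \<in> pts A" for n x using aut_pow_in[OF A that] .
  have add_zmax: "U m + U n = (if m \<le> n then U n else U m)" for m n
    by (simp add: plus_zmax_def max_def)
  have z: "Zero + l = l" "l + Zero = l" for l
    using add_0_left[of l] add_0_right[of l] unfolding zero_zmax_def by auto
  have mx: "c = a"
    if "a \<in> pts A" "b \<in> pts A" "c \<in> pts A"
      "(a, c) \<in> ord A" "(b, c) \<notin> ord A" "(a, b) \<notin> ord A" for a b c
    using that total[of a b] total[of b c] trans[of c b a] antisym[of a c] by simp
  have assoc: "add (vee A) (add (vee A) x y) z = add (vee A) x (add (vee A) y z)"
    if "x \<in> carrier (vee A)" "y \<in> carrier (vee A)" "z \<in> carrier (vee A)" for x y z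
    using that by (auto simp: vee_def split: option.splits dest: mx trans)
  have comm: "add (vee A) x y = add (vee A) y x"
    if "x \<in> carrier (vee A)" "y \<in> carrier (vee A)" for x y
    using that by (auto simp: vee_def split: option.splits dest: total antisym)
  have d1: "smult (vee A) l (add (vee A) x y) = add (vee A) (smult (vee A) l x) (smult (vee A) l y)"
    if "x \<in> carrier (vee A)" "y \<in> carrier (vee A)" for l x y
    using that aut_pow_ord[OF A] by (cases l) (auto simp: vee_def split: option.splits)
  have d2: "smult (vee A) (l + m) x = add (vee A) (smult (vee A) l x) (smult (vee A) m x)"
    if "x \<in> carrier (vee A)" for l m x
    using that exp by (cases l; cases m) (auto simp: vee_def z add_zmax split: option.splits)
  have d3: "smult (vee A) (l * m) x = smult (vee A) l (smult (vee A) m x)"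
    if "x \<in> carrier (vee A)" for l m x
    using that aut_pow_add[OF A] by (cases l; cases m) (auto simp: vee_def split: option.splits)
  have d4: "smult (vee A) 1 x = x" "smult (vee A) 0 x = zero (vee A)" "add (vee A) (zero (vee A)) x = x"
    if "x \<in> carrier (vee A)" for x
    using that by (auto simp: vee_def one_zmax_def zero_zmax_def aut_pow_def split: option.splits)
  have c: "zero (vee A) \<in> carrier (vee A)"
    "x \<in> carrier (vee A) \<Longrightarrow> smult (vee A) l x \<in> carrier (vee A)"
    "x \<in> carrier (vee A) \<Longrightarrow> y \<in> carrier (vee A) \<Longrightarrow> add (vee A) x y \<in> carrier (vee A)" for l x y
    using in' by (auto simp: vee_def split: option.splits zmax.splits)
  show ?thesis unfolding semimodule_def
    by (intro conjI allI ballI) (simp_all add: assoc d1 d2 d3 d4 c, rule comm)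
qed

lemma semimodule_zmax: "semimodule zmax_semimod"
  by (simp add: semimodule_def zmax_semimod_def algebra_simps)

lemma semimodule_Hom:
  assumes E: "semimodule E" and M: "semimodule M"
  shows "semimodule (Hom_semimod E M)"
proof -
  have cE: "x \<in> carrier E \<Longrightarrow> y \<in> carrier E \<Longrightarrow> add E x y \<in> carrier E"
    "x \<in> carrier E \<Longrightarrow> smult E l x \<in> carrier E" for l x y
    using E by (auto simp: semimodule_def)
  have c: "zero M \<in> carrier M" "x \<in> carrier M \<Longrightarrow> smult M l x \<in> carrier M"
    "x \<in> carrier M \<Longrightarrow> y \<in> carrier M \<Longrightarrow> add M x y \<in> carrier M" for l x y
    using M by (auto simp: semimodule_def)
  have assoc: "add M (add M x y) z = add M x (add M y z)"
    if "x \<in> carrier M" "y \<in> carrier M" "z \<in> carrier M" for x y z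
    using M that by (auto simp: semimodule_def)
  have comm: "add M x y = add M y x" if "x \<in> carrier M" "y \<in> carrier M" for x y
    using M that by (auto simp: semimodule_def)
  have ac4: "add M (add M x y) (add M z w) = add M (add M x z) (add M y w)"
    if "x \<in> carrier M" "y \<in> carrier M" "z \<in> carrier M" "w \<in> carrier M" for x y z w
    using that by (metis assoc comm c(3))
  have sm: "add M (zero M) x = x" "smult M 0 x = zero M" "smult M 1 x = x"
    "smult M (l * m) x = smult M l (smult M m x)"
    "smult M (l + m) x = add M (smult M l x) (smult M m x)"
    "y \<in> carrier M \<Longrightarrow> smult M l (add M x y) = add M (smult M l x) (smult M l y)"
    if "x \<in> carrier M" for l m x y
    using M that by (auto simp: semimodule_def)
  have s0: "smult M l (zero M) = zero M" for l
    using sm(2,4)[OF c(1)] by (metis mult_zero_right)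
  have swap: "smult M l (smult M m x) = smult M m (smult M l x)" if "x \<in> carrier M" for l m x
    using sm(4)[OF that] by (metis mult.commute)
  have HD: "f x \<in> carrier M" "f (smult E l x) = smult M l (f x)"
    "y \<in> carrier E \<Longrightarrow> f (add E x y) = add M (f x) (f y)"
    if "f \<in> Hom E M" "x \<in> carrier E" for f x y l
    using that by (auto simp: Hom_def PiE_def Pi_def)
  have HI: "restrict f (carrier E) \<in> Hom E M"
    if "\<And>x. x \<in> carrier E \<Longrightarrow> f x \<in> carrier M"
      "\<And>x y. x \<in> carrier E \<Longrightarrow> y \<in> carrier E \<Longrightarrow> f (add E x y) = add M (f x) (f y)"
      "\<And>l x. x \<in> carrier E \<Longrightarrow> f (smult E l x) = smult M l (f x)" for f
    using that cE by (simp add: Hom_def)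
  have HX: "f x = undefined" if "f \<in> Hom E M" "x \<notin> carrier E" for f x
    using that by (auto simp: Hom_def PiE_def extensional_def)
  have h0: "(\<lambda>x\<in>carrier E. zero M) \<in> Hom E M"
    by (rule HI) (simp_all add: c sm s0)
  have ha: "(\<lambda>x\<in>carrier E. add M (f x) (g x)) \<in> Hom E M" if "f \<in> Hom E M" "g \<in> Hom E M" for f g
    using that by (intro HI) (simp_all add: c HD ac4 sm)
  have hs: "(\<lambda>x\<in>carrier E. smult M l (f x)) \<in> Hom E M" if "f \<in> Hom E M" for f l
    using that by (intro HI) (simp_all add: c HD swap[of _ _ l] sm(6))
  show ?thesis
    unfolding semimodule_def Hom_semimod_def
    by (intro conjI allI ballI)
      (auto simp: h0 ha hs fun_eq_iff assoc sm c HD(1) HX intro: comm)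
qed

lemma vee_zshift:
  "carrier (vee (zshift n)) = UNIV"
  "add (vee (zshift n)) (Some a) (Some b) = Some (max a b)"
  "add (vee (zshift n)) None x = x" "add (vee (zshift n)) x None = x"
  "smult (vee (zshift n)) Zero x = None"
  "smult (vee (zshift n)) l None = None"
  "smult (vee (zshift n)) (U k) (Some a) = Some (a + k * int n)"
proof -
  have inv: "aut_inv (zshift n) = (\<lambda>x. x - int n)"
    unfolding aut_inv_def zshift_def
    by (auto intro!: ext inv_f_eq injI)
  have 1: "((\<lambda>x. x + int n) ^^ k) x = x + int k * int n" for k x
    by (induction k) (auto simp: algebra_simps)
  have 2: "((\<lambda>x. x - int n) ^^ k) x = x - int k * int n" for k x
    by (induction k) (auto simp: algebra_simps)
  have "aut_pow (zshift n) k a = a + k * int n"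
    unfolding aut_pow_def inv by (auto simp: zshift_def 1 2)
  then show "smult (vee (zshift n)) (U k) (Some a) = Some (a + k * int n)"
    by (simp add: vee_def)
qed (auto simp: vee_def zshift_def max_def UNIV_option_conv[symmetric] split: option.splits zmax.splits)

lemma cyc_maps_iff_Hom:
  "f \<in> cyc_maps n m \<longleftrightarrow> map_option f \<in> Hom (vee (zshift (n + 1))) (vee (zshift (m + 1)))"
proof
  let ?E = "vee (zshift (n + 1))" and ?M = "vee (zshift (m + 1))"
  assume f: "f \<in> cyc_maps n m"
  then have mono: "mono f" and step: "f (x + int n + 1) = f x + int m + 1" for x
    by (auto simp: cyc_maps_def)
  have shift: "f (x + k * int (n + 1)) = f x + k * int (m + 1)" for x k
  proof (induction k rule: int_induct[where k = 0])
    case (step1 i)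
    then show ?case using step[of "x + i * int (n + 1)"] by (simp add: algebra_simps)
  next
    case (step2 i)
    then show ?case using step[of "x + (i - 1) * int (n + 1)"] by (simp add: algebra_simps)
  qed simp
  have "map_option f (add ?E x y) = add ?M (map_option f x) (map_option f y)" for x y
    by (cases x; cases y)
      (auto simp: vee_zshift max_of_mono[OF mono])
  moreover have "map_option f (smult ?E l x) = smult ?M l (map_option f x)" for l x
    by (cases x; cases l) (simp_all only: vee_zshift option.map shift)
  ultimately show "map_option f \<in> Hom ?E ?M" by (simp add: Hom_def vee_zshift(1))
next
  let ?E = "vee (zshift (n + 1))" and ?M = "vee (zshift (m + 1))"
  assume "map_option f \<in> Hom ?E ?M"
  then have a: "map_option f (add ?E x y) = add ?M (map_option f x) (map_option f y)"
    and s: "map_option f (smult ?E l x) = smult ?M l (map_option f x)" for x y l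
    by (auto simp: Hom_def vee_zshift(1))
  have "mono f"
  proof
    fix x y :: int assume "x \<le> y"
    then show "f x \<le> f y" using a[of "Some x" "Some y"] by (simp add: vee_zshift max_def split: if_splits)
  qed
  moreover have "f (x + int n + 1) = f x + int m + 1" for x
    using s[of "U 1" "Some x"] by (simp add: vee_zshift algebra_simps)
  ultimately show "f \<in> cyc_maps n m" by (simp add: cyc_maps_def)
qed

lemma Hom_zero_kernel:
  assumes "F -` {None} = {None}"
  shows "\<exists>!f. F = map_option f"
proof (rule ex1I)
  have "F x = None \<longleftrightarrow> x = None" for x
    using assms by (metis vimage_singleton_eq singleton_iff)
  then have "F x = map_option (\<lambda>x. the (F (Some x))) x" for x
    by (cases x) (simp_all add: option.expand)
  then show "F = map_option (\<lambda>x. the (F (Some x)))" by (rule ext)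
  fix f assume "F = map_option f"
  then show "f = (\<lambda>x. the (F (Some x)))" by auto
qed

end

theory Submission
  imports Defs
begin

text \<open>The pairing is characterised by the Galois connection
  \<open>\<langle>x, y\<rangle> \<le> v \<longleftrightarrow> x \<le> v y\<close>, because the infimum is attained. This yields bilinearity, and for
  the integers it shows that a non-zero linear form \<open>\<phi>\<close> is the pairing with the greatest \<open>y\<close> such
  that \<open>\<phi> y \<le> 1\<close>. Applied to \<open>v = 1\<close>, it identifies the transpose \<open>f\<^sup>*\<close> as the right adjoint of
  \<open>f\<close>, while \<open>f\<^sup>t\<close> is the left adjoint; hence the two operations are mutually inverse.\<close>

section \<open>The pairing\<close>

lemma archimedean_refl: "archimedean_set A \<Longrightarrow> x \<in> pts A \<Longrightarrow> (x, x) \<in> ord A"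
  by (auto simp: archimedean_set_def linear_order_on_def partial_order_on_def preorder_on_def
      refl_on_def)

lemma archimedean_trans:
  "archimedean_set A \<Longrightarrow> (x, y) \<in> ord A \<Longrightarrow> (y, z) \<in> ord A \<Longrightarrow> (x, z) \<in> ord A"
  unfolding archimedean_set_def linear_order_on_def partial_order_on_def preorder_on_def
  by (blast dest: transD)

lemma archimedean_antisym:
  "archimedean_set A \<Longrightarrow> (x, y) \<in> ord A \<Longrightarrow> (y, x) \<in> ord A \<Longrightarrow> x = y"
  unfolding archimedean_set_def linear_order_on_def partial_order_on_def
  by (blast dest: antisymD)

lemma archimedean_total:
  assumes "archimedean_set A" "x \<in> pts A" "y \<in> pts A"
  shows "(x, y) \<in> ord A \<or> (y, x) \<in> ord A"
  using assms archimedean_refl[of A x]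
  unfolding archimedean_set_def linear_order_on_def total_on_def by (cases "x = y") auto

text \<open>Since \<open>aut A\<close> moves every point strictly upwards, a smaller exponent cannot
  give a larger point: otherwise \<open>aut A z\<close> would lie below \<open>z\<close> for a point
  \<open>z\<close> of the orbit.\<close>

lemma aut_pow_le_iff:
  assumes A: "archimedean_set A" and x: "x \<in> pts A"
  shows "(aut_pow A m x, aut_pow A n x) \<in> ord A \<longleftrightarrow> m \<le> n"
proof
  assume *: "(aut_pow A m x, aut_pow A n x) \<in> ord A"
  show "m \<le> n"
  proof (rule ccontr)
    assume "\<not> m \<le> n"
    then have "(aut_pow A (n + 1) x, aut_pow A m x) \<in> ord A"
      by (intro aut_pow_mono_exp[OF A x]) simp
    then have "(aut A (aut_pow A n x), aut_pow A n x) \<in> ord A"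
      using archimedean_trans[OF A _ *] aut_pow_Suc[OF A x] by simp
    then show False
      using A aut_pow_in[OF A x] archimedean_antisym[OF A] unfolding archimedean_set_def by blast
  qed
qed (rule aut_pow_mono_exp[OF A x])

text \<open>Translates the action on the dual into the original one with inverted exponent.
  \<open>aut_inv\<close> is an inverse on \<open>pts A\<close> only, so the induction relies on the
  iterates staying there.\<close>

lemma aut_pow_opp:
  assumes A: "archimedean_set A" and x: "x \<in> pts A"
  shows "aut_pow (opp A) n x = aut_pow A (- n) x"
proof -
  note B = archimedean_set_opp[OF A]
  have inv: "aut_inv (opp A) y = aut A y" if "y \<in> pts A" for y
    using aut_inv(3)[OF B, of "aut A y"] aut_inv(3,4)[OF A that] that by (simp add: opp_def)
  have "(aut_inv (opp A) ^^ k) x = (aut A ^^ k) x" for k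
    by (induction k) (simp_all add: inv aut_funpow(1)[OF A x])
  \<comment> \<open>For \<open>n = 0\<close> both exponents \<open>n\<close> and \<open>- n\<close>
    fall into the non-negative branch of \<open>aut_pow\<close>; otherwise they fall into opposite
    branches.\<close>
  then show ?thesis
    by (cases "n = 0") (auto simp: aut_pow_def, simp_all add: opp_def)
qed

section \<open>Coordinate formulas for the semimodule\<close>

lemma vee_smult [simp]:
  "smult (vee A) l None = None" "smult (vee A) Zero x = None"
  "smult (vee A) (U n) (Some a) = Some (aut_pow A n a)"
  by (simp_all add: vee_def split: zmax.splits)

lemma vee_carrier [simp]: "None \<in> carrier (vee A)" "Some a \<in> carrier (vee A) \<longleftrightarrow> a \<in> pts A"
  by (auto simp: vee_def)

lemma vee_zero [simp]: "zero (vee A) = None"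
  by (simp add: vee_def)

lemma vee_add [simp]:
  "add (vee A) None x = x" "add (vee A) x None = x"
  "add (vee A) (Some a) (Some b) = Some (if (a, b) \<in> ord A then b else a)"
  by (simp_all add: vee_def split: option.splits)

lemma vee_le_simps [simp]:
  "vee_le A None x" "\<not> vee_le A (Some a) None"
  "vee_le A (Some a) (Some b) \<longleftrightarrow> (a, b) \<in> ord A"
  by (simp_all add: vee_le_def)

lemma vee_closed:
  assumes "archimedean_set A" "x \<in> carrier (vee A)"
  shows "smult (vee A) l x \<in> carrier (vee A)"
    "y \<in> carrier (vee A) \<Longrightarrow> add (vee A) x y \<in> carrier (vee A)"
  using semimodule_vee[OF assms(1)] assms(2) by (auto simp: semimodule_def)

lemma opp_simps [simp]: "pts (opp A) = pts A" "(x, y) \<in> ord (opp A) \<longleftrightarrow> (y, x) \<in> ord A"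
  by (simp_all add: opp_def)

lemma carrier_vee_dual: "carrier (vee_dual A) = carrier (vee A)"
  by (simp add: vee_def)

lemma zmax_le_simps [simp]: "x \<le> Zero \<longleftrightarrow> x = Zero"
  by (cases x) auto

lemma vee_le_smult_scalar:
  assumes A: "archimedean_set A" and y: "y \<in> pts A"
    and "vee_le A x (smult (vee A) v (Some y))" "v \<le> w"
  shows "vee_le A x (smult (vee A) w (Some y))"
proof (cases x; cases v; cases w)
  fix a m n assume *: "x = Some a" "v = U m" "w = U n"
  then have "(a, aut_pow A m y) \<in> ord A" "m \<le> n" using assms(3,4) by simp_all
  then have "(a, aut_pow A n y) \<in> ord A"
    using archimedean_trans[OF A] aut_pow_mono_exp[OF A y] by blast
  with * show ?thesis by simp
qed (use assms(3,4) in simp_all)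

text \<open>The archimedean axiom, applied from \<open>y\<close> to \<open>x\<close>, keeps the
  infimum from being taken over the empty set, where it has no meaning.\<close>

lemma ex_smult_ge:
  assumes A: "archimedean_set A" and x: "x \<in> carrier (vee A)" and y: "y \<in> pts A"
  shows "\<exists>v. vee_le A x (smult (vee A) v (Some y))"
proof (cases x)
  case (Some a)
  with x have "a \<in> pts A" by simp
  with A y obtain n where "(a, (aut A ^^ n) y) \<in> ord A"
    unfolding archimedean_set_def by blast
  then have "vee_le A x (smult (vee A) (U (int n)) (Some y))"
    using Some by (simp add: aut_pow_def)
  then show ?thesis by blast
qed simp

text \<open>For non-zero \<open>x\<close> the archimedean axiom, now applied from \<open>x\<close>
  to \<open>y\<close>, bounds the admissible exponents below, so a non-empty set of them has a
  minimum. For \<open>x = None\<close> the scalar \<open>Zero\<close> is itself admissible and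
  least.\<close>

lemma pairing_le:
  assumes A: "archimedean_set A" and x: "x \<in> carrier (vee A)" and y: "y \<in> pts A"
  shows "pairing A x (Some y) \<le> v \<longleftrightarrow> vee_le A x (smult (vee A) v (Some y))"
proof -
  let ?S = "{v. vee_le A x (smult (vee A) v (Some y))}"
  have "\<exists>m\<in>?S. \<forall>w\<in>?S. m \<le> w"
  proof (cases x)
    case None
    then show ?thesis by (intro bexI[of _ Zero]) auto
  next
    case (Some a)
    then have a: "a \<in> pts A" using x by simp
    obtain n where n: "(y, (aut A ^^ n) a) \<in> ord A"
      using A a y unfolding archimedean_set_def by blast
    have "U (- int n) \<le> w" if "w \<in> ?S" for w
    proof (cases w)
      case Zero
      then show ?thesis using that Some by simp
    next
      case (U k)
      then have "(a, aut_pow A k y) \<in> ord A" using that Some by simp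
      \<comment> \<open>Applying the \<open>n\<close>-th power of the automorphism to both sides
        makes the inequality composable with the choice of \<open>n\<close>; this compares
        \<open>y\<close> with its own translate and forces \<open>0 \<le> n + k\<close>.\<close>
      then have "(aut_pow A (int n) a, aut_pow A (int n + k) y) \<in> ord A"
        using aut_pow_ord[OF A a aut_pow_in[OF A y]] aut_pow_add[OF A y] by simp
      then have "((aut A ^^ n) a, aut_pow A (int n + k) y) \<in> ord A"
        by (simp add: aut_pow_def[of A "int n"])
      with n have "(aut_pow A 0 y, aut_pow A (int n + k) y) \<in> ord A"
        using archimedean_trans[OF A n] by (simp add: aut_pow_def[of A 0])
      then show ?thesis using U by (simp add: aut_pow_le_iff[OF A y])
    qed
    then show ?thesis using ex_smult_ge[OF A x y] by (intro zmax_has_least[of _ "- int n"]) auto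
  qed
  then obtain m where m: "m \<in> ?S" "\<And>w. w \<in> ?S \<Longrightarrow> m \<le> w" by blast
  have "Inf ?S = m" using m by (rule cInf_eq_minimum)
  then have "pairing A x (Some y) = m" by (simp add: pairing_def)
  then show ?thesis using m vee_le_smult_scalar[OF A y] by blast
qed

lemma pairing_None [simp]: "pairing A x None = Zero"
  by (simp add: pairing_def zero_zmax_def)

section \<open>Bilinearity, by comparing upper bounds\<close>

lemma zmax_eqI: "(\<And>v. p \<le> v \<longleftrightarrow> q \<le> v) \<Longrightarrow> p = (q::zmax)"
  by (meson order.antisym order.refl)

lemma U_times_le: "U n * p \<le> v \<longleftrightarrow> p \<le> U (- n) * v"
  by (cases p; cases v) auto

lemma plus_zmax_le: "p + q \<le> v \<longleftrightarrow> p \<le> v \<and> q \<le> (v::zmax)"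
  by (simp add: plus_zmax_def)

lemma vee_le_add:
  assumes A: "archimedean_set A" and "x \<in> carrier (vee A)" "x' \<in> carrier (vee A)"
  shows "vee_le A (add (vee A) x x') z \<longleftrightarrow> vee_le A x z \<and> vee_le A x' z"
proof (cases "x = None \<or> x' = None \<or> z = None")
  case False
  then obtain a b c where *: "x = Some a" "x' = Some b" "z = Some c" by auto
  then have "(a, b) \<in> ord A \<or> (b, a) \<in> ord A"
    using assms(2,3) archimedean_total[OF A] by simp
  then show ?thesis using archimedean_trans[OF A] unfolding * by (simp, blast)
qed (cases x; cases x'; cases z; simp split: if_splits)+

text \<open>Apply the order automorphism with exponent \<open>- n\<close> to both sides.\<close>

lemma vee_le_smult:
  assumes A: "archimedean_set A" and x: "x \<in> carrier (vee A)" and y: "y \<in> pts A"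
  shows "vee_le A (smult (vee A) (U n) x) (smult (vee A) v (Some y)) \<longleftrightarrow>
    vee_le A x (smult (vee A) (U (- n) * v) (Some y))"
proof (cases x; cases v)
  fix a k assume *: "x = Some a" "v = U k"
  then have "a \<in> pts A" using x by simp
  with * show ?thesis
    using aut_pow_ord[OF A, of "aut_pow A n a" "aut_pow A k y" "- n"]
      aut_pow_add[OF A, of a "- n" n] aut_pow_add[OF A y, of "- n" k] aut_pow_in[OF A] y
    by (simp add: aut_pow_def[of A 0])
qed auto

lemma pairing_add_left:
  assumes A: "archimedean_set A" and "x \<in> carrier (vee A)" "x' \<in> carrier (vee A)"
    and y: "y \<in> carrier (vee A)"
  shows "pairing A (add (vee A) x x') y = pairing A x y + pairing A x' y"
proof (cases y)
  case (Some b)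
  with y have "b \<in> pts A" by simp
  with Some assms(2,3) vee_closed(2)[OF A] show ?thesis
    by (intro zmax_eqI) (simp add: plus_zmax_le pairing_le[OF A] vee_le_add[OF A])
qed (simp add: plus_zmax_def)

lemma pairing_smult_left:
  assumes A: "archimedean_set A" and x: "x \<in> carrier (vee A)" and y: "y \<in> carrier (vee A)"
  shows "pairing A (smult (vee A) l x) y = l * pairing A x y"
proof (cases y; cases l)
  fix b assume "y = Some b" "l = Zero"
  then show ?thesis using pairing_le[OF A, of None b Zero] y by simp
next
  fix b n assume "y = Some b" "l = U n"
  then show ?thesis using vee_closed(1)[OF A x] x y
    by (intro zmax_eqI) (simp add: U_times_le pairing_le[OF A] vee_le_smult[OF A])
qed simp_all

text \<open>Addition in the dual is the minimum for the original order. Scalars preserve this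
  minimum, and \<open>x\<close> lies below a minimum exactly when it lies below both
  elements.\<close>

lemma vee_le_add_dual:
  assumes A: "archimedean_set A" and y: "b \<in> pts A" "b' \<in> pts A"
  shows "vee_le A x (smult (vee A) v (add (vee_dual A) (Some b) (Some b'))) \<longleftrightarrow>
    vee_le A x (smult (vee A) v (Some b)) \<and> vee_le A x (smult (vee A) v (Some b'))"
proof (cases x; cases v)
  fix a n assume *: "x = Some a" "v = U n"
  have "(b, b') \<in> ord A \<or> (b', b) \<in> ord A" using archimedean_total[OF A y] .
  then have "(aut_pow A n b, aut_pow A n b') \<in> ord A \<and> (b, b') \<in> ord A \<or>
    (aut_pow A n b', aut_pow A n b) \<in> ord A \<and> (b', b) \<in> ord A"
    using aut_pow_ord[OF A] y by simp
  then show ?thesis using archimedean_trans[OF A] archimedean_antisym[OF A, of b b']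
    unfolding * by (simp, blast)
qed auto

lemma pairing_add_right:
  assumes A: "archimedean_set A" and x: "x \<in> carrier (vee A)"
    and y: "y \<in> carrier (vee A)" "y' \<in> carrier (vee A)"
  shows "pairing A x (add (vee_dual A) y y') = pairing A x y + pairing A x y'"
proof (cases y; cases y')
  fix b b' assume yy: "y = Some b" "y' = Some b'"
  then obtain c where "add (vee_dual A) (Some b) (Some b') = Some c" "c \<in> pts A"
    using y by auto
  then show ?thesis using x y yy vee_le_add_dual[OF A, of b b']
    by (intro zmax_eqI) (simp add: plus_zmax_le pairing_le[OF A] del: vee_add)
qed (simp_all add: plus_zmax_def)

text \<open>The scalar \<open>U n\<close> acts on the dual with exponent \<open>- n\<close>, which
  can be absorbed into \<open>v\<close>; \<open>U_times_le\<close> then moves it to the other side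
  as the factor \<open>U n\<close>.\<close>

lemma pairing_smult_right:
  assumes A: "archimedean_set A" and x: "x \<in> carrier (vee A)" and y: "y \<in> carrier (vee A)"
  shows "pairing A x (smult (vee_dual A) l y) = l * pairing A x y"
proof (cases y; cases l)
  fix b n assume yl: "y = Some b" "l = U n"
  then have b: "b \<in> pts A" using y by simp
  have "smult (vee A) v (Some (aut_pow A (- n) b)) = smult (vee A) (U (- n) * v) (Some b)" for v
    by (cases v) (simp_all add: aut_pow_add[OF A b, symmetric] add.commute)
  then show ?thesis using x b yl aut_pow_in[OF A b]
    by (intro zmax_eqI) (simp add: aut_pow_opp[OF A b] U_times_le pairing_le[OF A])
qed simp_all

lemma bilinear_map_pairing:
  assumes A: "archimedean_set A"
  shows "bilinear_map (vee A) (vee_dual A) zmax_semimod (pairing A)"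
  unfolding bilinear_map_def Hom_def zmax_semimod_def
  using vee_closed[OF A] vee_closed[OF archimedean_set_opp[OF A]]
  by (auto simp: carrier_vee_dual pairing_add_left[OF A] pairing_smult_left[OF A]
      pairing_add_right[OF A] pairing_smult_right[OF A])


section \<open>Duality for shifts of the integers\<close>

lemma zshift_simps [simp]:
  "pts (zshift n) = UNIV" "(x, y) \<in> ord (zshift n) \<longleftrightarrow> x \<le> y"
  "carrier (vee (zshift n)) = UNIV" "carrier (vee_dual (zshift n)) = UNIV"
  by (simp_all add: zshift_def vee_zshift(1)[unfolded zshift_def] carrier_vee_dual)

lemma aut_pow_zshift [simp]: "aut_pow (zshift n) k a = a + k * int n"
  using vee_zshift(7)[of n k a] by simp

text \<open>In other words, the pairing of two non-zero elements is \<open>U k\<close> with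
  \<open>k\<close> the ceiling of \<open>(x - y) / n\<close>.\<close>

lemma pairing_zshift_le:
  assumes "n \<ge> 1"
  shows "pairing (zshift n) (Some x) (Some y) \<le> U k \<longleftrightarrow> x \<le> y + k * int n"
    "pairing (zshift n) (Some x) (Some y) \<noteq> Zero"
  using pairing_le[OF archimedean_set_zshift[OF assms], of "Some x" y "U k"]
    pairing_le[OF archimedean_set_zshift[OF assms], of "Some x" y Zero]
  by simp_all

lemma pairing_zshift_None [simp]: "n \<ge> 1 \<Longrightarrow> pairing (zshift n) None y = Zero"
  using pairing_le[OF archimedean_set_zshift, of n None _ Zero] by (cases y) simp_all

text \<open>Non-degeneracy in the second argument, the source of every uniqueness claim about \<ell>
  and about transposes. A non-zero \<open>y\<close> is told apart from \<open>None\<close> because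
  its pairing with a non-zero element never vanishes.\<close>

lemma pairing_zshift_cancel:
  assumes n: "n \<ge> 1" and eq: "\<And>x. pairing (zshift n) x y = pairing (zshift n) x y'"
  shows "y = y'"
proof (cases y; cases y')
  fix a b assume *: "y = Some a" "y' = Some b"
  \<comment> \<open>The level \<open>U 0\<close> of the pairing already recovers the down-set of
    each point.\<close>
  have "x \<le> a \<longleftrightarrow> x \<le> b" for x
    using eq[of "Some x"] * pairing_zshift_le(1)[OF n, of x a 0] pairing_zshift_le(1)[OF n, of x b 0]
    by simp
  then show ?thesis using * by (metis order.antisym order.refl)
qed (use eq pairing_zshift_le(2)[OF n] in \<open>auto, metis pairing_None\<close>)

section \<open>Representability of linear forms\<close>

lemma int_has_greatest:
  fixes P :: "int \<Rightarrow> bool"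
  assumes "P a" and "\<And>x. P x \<Longrightarrow> x \<le> b"
  shows "\<exists>m. P m \<and> (\<forall>x. P x \<longrightarrow> x \<le> m)"
proof -
  have "\<exists>m\<in>U ` {x. P x}. \<forall>x\<in>U ` {x. P x}. x \<le> m"
    by (rule zmax_bounded_has_greatest[of _ "U b"]) (use assms in auto)
  then show ?thesis by auto
qed

lemma int_has_least:
  fixes P :: "int \<Rightarrow> bool"
  assumes "P a" and "\<And>x. P x \<Longrightarrow> b \<le> x"
  shows "\<exists>m. P m \<and> (\<forall>x. P x \<longrightarrow> m \<le> x)"
proof -
  have "\<exists>m\<in>U ` {x. P x}. \<forall>x\<in>U ` {x. P x}. m \<le> x"
    by (rule zmax_has_least[of _ b]) (use assms in auto)
  then show ?thesis by auto
qed

lemma int_le_plus_mult: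
  assumes "n \<ge> 1"
  shows "\<exists>k. (x::int) \<le> a + k * int n"
proof -
  \<comment> \<open>Taking \<open>k\<close> non-negative ensures that multiplying it by
    \<open>n\<close> does not decrease it.\<close>
  obtain k where k: "0 \<le> k" "x - a \<le> k" by (meson max.cobounded1 max.cobounded2)
  then have "k * 1 \<le> k * int n" using assms by (intro mult_left_mono) simp_all
  then have "x \<le> a + k * int n" using k by linarith
  then show ?thesis ..
qed

text \<open>A linear form is monotone and picks up the factor \<open>U k\<close> under translation
  by \<open>k * n\<close>. Hence it is fixed by its sublevel set at \<open>U 0\<close>, and it
  vanishes on all non-zero elements once it vanishes at one.\<close>

lemma linear_form_zshift:
  assumes n: "n \<ge> 1" and phi: "\<phi> \<in> Hom (vee (zshift n)) zmax_semimod"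
  shows "\<exists>y. \<forall>x. \<phi> x = pairing (zshift n) x y"
proof -
  have add: "\<phi> (add (vee (zshift n)) x y) = max (\<phi> x) (\<phi> y)"
    and smult: "\<phi> (smult (vee (zshift n)) l x) = l * \<phi> x" for x y l
    using phi by (auto simp: Hom_def zmax_semimod_def plus_zmax_def)
  have zero: "\<phi> None = Zero" using smult[of Zero None] by simp
  \<comment> \<open>For \<open>a \<le> b\<close> the sum of \<open>a\<close> and \<open>b\<close> is
    \<open>b\<close>, so additivity gives monotonicity.\<close>
  have mono: "\<phi> (Some a) \<le> \<phi> (Some b)" if "a \<le> b" for a b
    using add[of "Some a" "Some b"] that by (simp add: max_def split: if_splits)
  have shift: "\<phi> (Some (a + k * int n)) = U k * \<phi> (Some a)" for a k
    using smult[of "U k" "Some a"] by simp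
  show ?thesis
  proof (cases "\<exists>a. \<phi> (Some a) = Zero")
    case True
    then obtain a where a: "\<phi> (Some a) = Zero" by blast
    have "\<phi> (Some b) = Zero" for b
    proof -
      obtain k where "b \<le> a + k * int n" using int_le_plus_mult[OF n] by blast
      from mono[OF this] show ?thesis by (simp add: shift a)
    qed
    then have "\<phi> x = pairing (zshift n) x None" for x using zero by (cases x) simp_all
    then show ?thesis by blast
  next
    case False
    then obtain c where c: "\<phi> (Some 0) = U c" by (cases "\<phi> (Some 0)") auto
    \<comment> \<open>Translating \<open>0\<close> by \<open>- c\<close> periods gives the value
      \<open>U 0\<close>, so the sublevel set is non-empty; one period further the value is
      \<open>U 1\<close>, which bounds the set above.\<close>
    have "\<phi> (Some (0 + (- c) * int n)) \<le> U 0" unfolding shift c by simp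
    moreover have "x \<le> (1 - c) * int n" if x: "\<phi> (Some x) \<le> U 0" for x
    proof (rule ccontr)
      assume "\<not> ?thesis"
      then have "\<phi> (Some (0 + (1 - c) * int n)) \<le> \<phi> (Some x)" by (intro mono) simp
      then show False using x unfolding shift c by (cases "\<phi> (Some x)") auto
    qed
    ultimately obtain y where y: "\<phi> (Some y) \<le> U 0" "\<And>x. \<phi> (Some x) \<le> U 0 \<Longrightarrow> x \<le> y"
      using int_has_greatest[of "\<lambda>x. \<phi> (Some x) \<le> U 0"] by blast
    have le0: "\<phi> (Some x) \<le> U 0 \<longleftrightarrow> x \<le> y" for x
      using y mono order.trans by blast
    have le: "\<phi> (Some x) \<le> U k \<longleftrightarrow> x \<le> y + k * int n" for x k
      using le0[of "x + (- k) * int n"] unfolding shift U_times_le by (auto simp: algebra_simps)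
    have "\<phi> x = pairing (zshift n) x (Some y)" for x
    proof (cases x)
      case (Some a)
      show ?thesis
      proof (rule zmax_eqI)
        show "\<phi> x \<le> v \<longleftrightarrow> pairing (zshift n) x (Some y) \<le> v" for v
          \<comment> \<open>At \<open>v = Zero\<close> both inequalities fail, since neither side
            vanishes.\<close>
          using False le pairing_zshift_le[OF n] Some by (cases v) auto
      qed
    qed (simp add: zero pairing_zshift_None[OF n])
    then show ?thesis by blast
  qed
qed

lemma Iso_pairing_zshift:
  assumes n: "n \<ge> 1"
  shows "(\<lambda>y\<in>carrier (vee_dual (zshift n)). \<lambda>x\<in>carrier (vee (zshift n)). pairing (zshift n) x y)
    \<in> Iso (vee_dual (zshift n)) (Hom_semimod (vee (zshift n)) zmax_semimod)"
    (is "?l \<in> _")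
proof -
  let ?A = "zshift n"
  note A = archimedean_set_zshift[OF n]
  have hom: "(\<lambda>x. pairing ?A x y) \<in> Hom (vee ?A) zmax_semimod" for y
    using bilinear_map_pairing[OF A] by (simp add: bilinear_map_def restrict_UNIV)
  have "?l \<in> Hom (vee_dual ?A) (Hom_semimod (vee ?A) zmax_semimod)"
    unfolding Hom_def[of "vee_dual ?A"]
    using hom pairing_add_right[OF A] pairing_smult_right[OF A]
    by (simp add: Hom_semimod_def restrict_UNIV PiE_def) (simp add: zmax_semimod_def)
  moreover have "bij_betw ?l UNIV (Hom (vee ?A) zmax_semimod)"
  proof (rule bij_betwI')
    show "?l y = ?l y' \<longleftrightarrow> y = y'" for y y'
      using pairing_zshift_cancel[OF n, of y y'] by (auto simp: fun_eq_iff)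
    show "?l y \<in> Hom (vee ?A) zmax_semimod" for y using hom by (simp add: restrict_UNIV)
    show "\<exists>y\<in>UNIV. \<phi> = ?l y" if "\<phi> \<in> Hom (vee ?A) zmax_semimod" for \<phi>
      using linear_form_zshift[OF n that] by (auto simp: fun_eq_iff)
  qed
  ultimately show ?thesis by (simp add: Iso_def Hom_semimod_def)
qed

text \<open>For fixed \<open>y\<close> the map sending \<open>x\<close> to the pairing of
  \<open>f x\<close> with \<open>y\<close> is a linear form, hence represented by some element,
  chosen as \<open>g y\<close>. Non-degeneracy yields both the linearity of \<open>g\<close> and its
  uniqueness.\<close>

lemma ex1_transpose_zshift:
  assumes n: "n \<ge> 1" and m: "m \<ge> 1" and f: "f \<in> Hom (vee (zshift n)) (vee (zshift m))"
  shows "\<exists>!g. is_transpose (zshift n) (zshift m) f g"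
proof -
  note A = archimedean_set_zshift[OF n] and B = archimedean_set_zshift[OF m]
  have fadd: "f (add (vee (zshift n)) x y) = add (vee (zshift m)) (f x) (f y)"
    and fsmult: "f (smult (vee (zshift n)) l x) = smult (vee (zshift m)) l (f x)" for x y l
    using f by (auto simp: Hom_def)
  have "(\<lambda>x. pairing (zshift m) (f x) y) \<in> Hom (vee (zshift n)) zmax_semimod" for y
    using pairing_add_left[OF B] pairing_smult_left[OF B]
    by (simp add: Hom_def zmax_semimod_def fadd fsmult)
  then have "\<exists>z. \<forall>x. pairing (zshift m) (f x) y = pairing (zshift n) x z" for y
    using linear_form_zshift[OF n] by blast
  then obtain g where g: "\<And>x y. pairing (zshift m) (f x) y = pairing (zshift n) x (g y)"
    by metis
  have "g (add (vee_dual (zshift m)) y y') = add (vee_dual (zshift n)) (g y) (g y')" for y y'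
    by (rule pairing_zshift_cancel[OF n])
      (simp add: g[symmetric] pairing_add_right[OF A] pairing_add_right[OF B])
  moreover have "g (smult (vee_dual (zshift m)) l y) = smult (vee_dual (zshift n)) l (g y)" for l y
    by (rule pairing_zshift_cancel[OF n])
      (simp add: g[symmetric] pairing_smult_right[OF A] pairing_smult_right[OF B])
  ultimately have "is_transpose (zshift n) (zshift m) f g"
    by (simp add: is_transpose_def Hom_def g)
  moreover have "h = g" if "is_transpose (zshift n) (zshift m) f h" for h
  proof
    show "h y = g y" for y
      using that by (intro pairing_zshift_cancel[OF n]) (simp add: is_transpose_def g[symmetric])
  qed
  ultimately show ?thesis by blast
qed

section \<open>Transposition in the cyclic category\<close>

lemma cyc_maps_mono: "f \<in> cyc_maps n m \<Longrightarrow> x \<le> y \<Longrightarrow> f x \<le> f y"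
  by (simp add: cyc_maps_def monoD)

text \<open>This is homogeneity of the associated linear map under \<open>U k\<close>.\<close>

lemma cyc_maps_shift:
  assumes "f \<in> cyc_maps n m"
  shows "f (x + k * (int n + 1)) = f x + k * (int m + 1)"
proof -
  have "map_option f (smult (vee (zshift (n + 1))) (U k) (Some x)) =
    smult (vee (zshift (m + 1))) (U k) (map_option f (Some x))"
    using assms by (simp add: cyc_maps_iff_Hom Hom_def del: vee_smult)
  then show ?thesis by (simp add: add.commute)
qed

text \<open>The trivial kernel makes \<open>the\<close> in \<open>cyc_star\<close> meaningful; the
  adjunction is the transposition identity read at level \<open>U 0\<close>.\<close>

lemma Hom_transpose_zshift:
  assumes f: "f \<in> cyc_maps n m"
  defines "G \<equiv> Hom_transpose (zshift (n + 1)) (zshift (m + 1)) (map_option f)"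
  shows "G -` {None} = {None}" and "f x \<le> y \<longleftrightarrow> x \<le> cyc_star n m f y"
proof -
  have "is_transpose (zshift (n + 1)) (zshift (m + 1)) (map_option f) G"
    unfolding G_def Hom_transpose_def
    by (rule theI'[OF ex1_transpose_zshift]) (use f in \<open>simp_all add: cyc_maps_iff_Hom\<close>)
  then have G: "pairing (zshift (m + 1)) (map_option f x) y = pairing (zshift (n + 1)) x (G y)"
    for x y by (simp add: is_transpose_def)
  \<comment> \<open>Pairing with \<open>None\<close> always gives \<open>Zero\<close>, so
    \<open>G None\<close> also pairs to \<open>Zero\<close> with everything.\<close>
  have "G None = None"
    by (rule pairing_zshift_cancel[of "n + 1"]) (simp, metis G pairing_None)
  \<comment> \<open>\<open>f 0\<close> is a non-zero element, so its pairing with a non-zero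
    \<open>y\<close> does not vanish.\<close>
  moreover have G_Some: "G (Some y) \<noteq> None" for y
    using G[of "Some 0" "Some y"] pairing_zshift_le(2)[of "m + 1" "f 0" y]
    by (cases "G (Some y)") simp_all
  ultimately show "G -` {None} = {None}" by (auto, metis option.exhaust)
  have "G (Some y) = Some (cyc_star n m f y)"
    using G_Some[of y] unfolding cyc_star_def G_def by simp
  then show "f x \<le> y \<longleftrightarrow> x \<le> cyc_star n m f y"
    using G[of "Some x" "Some y"] pairing_zshift_le(1)[of "m + 1" "f x" y 0]
      pairing_zshift_le(1)[of "n + 1" x "cyc_star n m f y" 0] by simp
qed

section \<open>Adjoints of cyclic maps\<close>

lemma right_adjoint_cyc_maps:
  assumes f: "f \<in> cyc_maps n m" and g: "\<And>x y. f x \<le> y \<longleftrightarrow> x \<le> g y"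
  shows "g \<in> cyc_maps m n"
proof -
  have "mono g" by (rule monoI) (use g in \<open>metis order.refl order.trans\<close>)
  moreover have "g (y + int m + 1) = g y + int n + 1" for y
  proof -
    \<comment> \<open>Transfer to \<open>f\<close> through the adjunction, move \<open>x\<close>
      down by one period, and transfer back.\<close>
    have "x \<le> g (y + int m + 1) \<longleftrightarrow> x \<le> g y + int n + 1" for x
      using g[of x "y + int m + 1"] g[of "x - int n - 1" y] cyc_maps_shift[OF f, of x "- 1"]
      by (auto simp: algebra_simps)
    then show ?thesis by (metis order.antisym order.refl)
  qed
  ultimately show ?thesis by (simp add: cyc_maps_def)
qed

lemma left_adjoint_cyc_maps:
  assumes f: "f \<in> cyc_maps n m" and g: "is_cyc_t f g"
  shows "g \<in> cyc_maps m n"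
proof -
  have g: "y \<le> f x \<longleftrightarrow> g y \<le> x" for x y using g by (simp add: is_cyc_t_def)
  have "mono g" by (rule monoI) (use g in \<open>metis order.refl order.trans\<close>)
  moreover have "g (y + int m + 1) = g y + int n + 1" for y
  proof -
    have "g (y + int m + 1) \<le> x \<longleftrightarrow> g y + int n + 1 \<le> x" for x
      using g[of "y + int m + 1" x] g[of y "x - int n - 1"] cyc_maps_shift[OF f, of x "- 1"]
      by (auto simp: algebra_simps)
    then show ?thesis by (metis order.antisym order.refl)
  qed
  ultimately show ?thesis by (simp add: cyc_maps_def)
qed

lemma is_cyc_t_unique: "is_cyc_t f g \<Longrightarrow> is_cyc_t f h \<Longrightarrow> h = g"
  unfolding is_cyc_t_def by (metis ext order.antisym order.refl)

lemma cyc_t_eqI: "is_cyc_t f g \<Longrightarrow> cyc_t f = g"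
  unfolding cyc_t_def by (rule the_equality) (auto dest: is_cyc_t_unique)

text \<open>The adjoint at \<open>y\<close> is the least \<open>x\<close> with
  \<open>y \<le> f x\<close>. It exists because translation by periods makes \<open>f\<close>
  unbounded in both directions.\<close>

lemma ex_is_cyc_t:
  assumes f: "f \<in> cyc_maps n m"
  shows "\<exists>g. is_cyc_t f g"
proof -
  have "\<exists>z. \<forall>x. y \<le> f x \<longleftrightarrow> z \<le> x" for y
  proof -
    obtain k where "y \<le> f 0 + k * int (m + 1)" using int_le_plus_mult[of "m + 1"] by auto
    then have "y \<le> f (0 + k * (int n + 1))"
      using cyc_maps_shift[OF f, of 0 k] by (simp add: add.commute)
    \<comment> \<open>The summand \<open>1\<close> makes the bound strict: \<open>j\<close> periods
      below \<open>0\<close> the value of \<open>f\<close> is less than \<open>y\<close>, so no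
      smaller argument can reach \<open>y\<close>.\<close>
    moreover obtain j where j: "- y + 1 \<le> - f 0 + j * int (m + 1)"
      using int_le_plus_mult[of "m + 1" "- y + 1" "- f 0"] by auto
    have "- j * (int n + 1) \<le> x" if "y \<le> f x" for x
    proof (rule ccontr)
      assume "\<not> ?thesis"
      then have "f x \<le> f (0 + (- j) * (int n + 1))" by (intro cyc_maps_mono[OF f]) simp
      also have "\<dots> = f 0 + (- j) * (int m + 1)" by (rule cyc_maps_shift[OF f])
      finally show False using that j by (simp add: algebra_simps)
    qed
    ultimately obtain z where "y \<le> f z" "\<And>x. y \<le> f x \<Longrightarrow> z \<le> x"
      using int_has_least[of "\<lambda>x. y \<le> f x"] by blast
    then show ?thesis using cyc_maps_mono[OF f] order.trans by blast
  qed
  then show ?thesis unfolding is_cyc_t_def by metis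
qed

lemma is_cyc_t_cyc_t: "f \<in> cyc_maps n m \<Longrightarrow> is_cyc_t f (cyc_t f)"
  using ex_is_cyc_t cyc_t_eqI by blast

lemma cyc_t_in: "f \<in> cyc_maps n m \<Longrightarrow> cyc_t f \<in> cyc_maps m n"
  using left_adjoint_cyc_maps is_cyc_t_cyc_t by blast

lemma cyc_star_in: "f \<in> cyc_maps n m \<Longrightarrow> cyc_star n m f \<in> cyc_maps m n"
  using right_adjoint_cyc_maps Hom_transpose_zshift(2) by blast

lemma cyc_star_eqI:
  assumes "f \<in> cyc_maps n m" and "\<And>x y. f x \<le> y \<longleftrightarrow> x \<le> g y"
  shows "cyc_star n m f = g"
  using Hom_transpose_zshift(2)[OF assms(1)] assms(2) by (metis ext order.antisym order.refl)

text \<open>\<open>cyc_t f\<close> is left adjoint to \<open>f\<close>, so \<open>f\<close> is the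
  right adjoint that \<open>cyc_star\<close> selects for it.\<close>

lemma cyc_star_cyc_t: "f \<in> cyc_maps n m \<Longrightarrow> cyc_star m n (cyc_t f) = f"
  using is_cyc_t_cyc_t[of f n m] by (intro cyc_star_eqI cyc_t_in) (simp_all add: is_cyc_t_def)

lemma cyc_t_cyc_star: "f \<in> cyc_maps n m \<Longrightarrow> cyc_t (cyc_star n m f) = f"
  by (rule cyc_t_eqI) (simp add: is_cyc_t_def Hom_transpose_zshift(2))

lemma id_in_cyc_maps: "id \<in> cyc_maps n n"
  by (simp add: cyc_maps_def mono_def)

lemma cyc_t_id: "cyc_t id = id"
  by (rule cyc_t_eqI) (simp add: is_cyc_t_def)

lemma comp_in_cyc_maps: "f \<in> cyc_maps n m \<Longrightarrow> g \<in> cyc_maps m k \<Longrightarrow> g \<circ> f \<in> cyc_maps n k"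
  by (simp add: cyc_maps_def mono_def)

text \<open>Left adjoints compose in the reverse order; hence contravariance.\<close>

lemma cyc_t_comp:
  assumes "f \<in> cyc_maps n m" "g \<in> cyc_maps m k"
  shows "cyc_t (g \<circ> f) = cyc_t f \<circ> cyc_t g"
  using is_cyc_t_cyc_t[OF assms(1)] is_cyc_t_cyc_t[OF assms(2)]
  by (intro cyc_t_eqI) (simp add: is_cyc_t_def)

section \<open>Passage to morphism classes\<close>

lemma equiv_cyc_rel: "equiv (cyc_maps n m) (cyc_rel n m)"
proof (rule equivI)
  show "refl_on (cyc_maps n m) (cyc_rel n m)"
    by (auto simp: refl_on_def cyc_rel_def intro!: exI[of _ 0])
  show "sym (cyc_rel n m)"
    by (rule symI) (force simp: cyc_rel_def intro: exI[of _ "- k" for k])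
  show "trans (cyc_rel n m)"
  proof (rule transI)
    fix f g h assume "(f, g) \<in> cyc_rel n m" "(g, h) \<in> cyc_rel n m"
    moreover from this obtain j k
      where "\<forall>x. g x = f x + j * (int m + 1)" "\<forall>x. h x = g x + k * (int m + 1)"
      unfolding cyc_rel_def by blast
    then have "\<forall>x. h x = f x + (j + k) * (int m + 1)" by (simp add: algebra_simps)
    ultimately show "(f, h) \<in> cyc_rel n m" unfolding cyc_rel_def by blast
  qed
qed (auto simp: cyc_rel_def)

lemma cyc_relE:
  assumes "(f, g) \<in> cyc_rel n m"
  obtains k where "f \<in> cyc_maps n m" "g \<in> cyc_maps n m" "\<And>x. g x = f x + k * (int m + 1)"
  using assms unfolding cyc_rel_def by blast

lemma cyc_class_eqI:
  assumes "f \<in> cyc_maps n m" "g \<in> cyc_maps n m" "\<And>x. g x = f x + k * (int m + 1)"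
  shows "cyc_class n m f = cyc_class n m g"
  using assms by (intro equiv_class_eq[OF equiv_cyc_rel]) (auto simp: cyc_rel_def)

text \<open>Raising \<open>f\<close> by \<open>k * (m + 1)\<close> precomposes its adjoint with the
  opposite translation, which the cyclic condition turns into subtracting
  \<open>k * (n + 1)\<close>.\<close>

lemma cyc_t_respects: "(\<lambda>f. cyc_class m n (cyc_t f)) respects cyc_rel n m"
proof (rule congruentI)
  fix f g assume "(f, g) \<in> cyc_rel n m"
  then obtain k where fg: "f \<in> cyc_maps n m" "g \<in> cyc_maps n m"
    "\<And>x. g x = f x + k * (int m + 1)" by (rule cyc_relE) blast
  have "is_cyc_t g (\<lambda>y. cyc_t f (y + (- k) * (int m + 1)))"
    unfolding is_cyc_t_def
  proof (intro allI)
    fix x y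
    have "y \<le> g x \<longleftrightarrow> y + (- k) * (int m + 1) \<le> f x" unfolding fg(3) by auto
    then show "y \<le> g x \<longleftrightarrow> cyc_t f (y + (- k) * (int m + 1)) \<le> x"
      using is_cyc_t_cyc_t[OF fg(1)] by (simp add: is_cyc_t_def)
  qed
  then have "cyc_t g y = cyc_t f y + (- k) * (int n + 1)" for y
    using cyc_t_eqI cyc_maps_shift[OF cyc_t_in[OF fg(1)], of y "- k"] by metis
  then show "cyc_class m n (cyc_t f) = cyc_class m n (cyc_t g)"
    by (intro cyc_class_eqI cyc_t_in fg)
qed

lemma cyc_star_respects: "(\<lambda>f. cyc_class m n (cyc_star n m f)) respects cyc_rel n m"
proof (rule congruentI)
  fix f g assume "(f, g) \<in> cyc_rel n m"
  then obtain k where fg: "f \<in> cyc_maps n m" "g \<in> cyc_maps n m"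
    "\<And>x. g x = f x + k * (int m + 1)" by (rule cyc_relE) blast
  have "g x \<le> y \<longleftrightarrow> x \<le> cyc_star n m f (y + (- k) * (int m + 1))" for x y
    using Hom_transpose_zshift(2)[OF fg(1), of x "y + (- k) * (int m + 1)"] fg(3)[of x]
    by (auto simp: algebra_simps)
  then have "cyc_star n m g = (\<lambda>y. cyc_star n m f (y + (- k) * (int m + 1)))"
    by (rule cyc_star_eqI[OF fg(2)])
  then have "cyc_star n m g y = cyc_star n m f y + (- k) * (int n + 1)" for y
    using cyc_maps_shift[OF cyc_star_in[OF fg(1)], of y "- k"] by metis
  then show "cyc_class m n (cyc_star n m f) = cyc_class m n (cyc_star n m g)"
    by (intro cyc_class_eqI cyc_star_in fg)
qed

text \<open>The inner constant \<open>j * (m + 1)\<close> passes through \<open>g\<close> as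
  \<open>j * (k + 1)\<close>, so the multiples add up.\<close>

lemma comp_respects2:
  "congruent2 (cyc_rel m k) (cyc_rel n m) (\<lambda>g f. cyc_class n k (g \<circ> f))"
proof (rule congruent2I')
  fix g g' f f' assume "(g, g') \<in> cyc_rel m k" "(f, f') \<in> cyc_rel n m"
  then obtain i j where g: "g \<in> cyc_maps m k" "g' \<in> cyc_maps m k"
      "\<And>x. g' x = g x + i * (int k + 1)"
    and f: "f \<in> cyc_maps n m" "f' \<in> cyc_maps n m" "\<And>x. f' x = f x + j * (int m + 1)"
    by (elim cyc_relE) blast
  have "(g' \<circ> f') x = (g \<circ> f) x + (i + j) * (int k + 1)" for x
    using cyc_maps_shift[OF g(1), of "f x" j] by (simp add: g(3) f(3) algebra_simps)
  then show "cyc_class n k (g \<circ> f) = cyc_class n k (g' \<circ> f')"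
    by (intro cyc_class_eqI comp_in_cyc_maps[OF f(1) g(1)] comp_in_cyc_maps[OF f(2) g(2)])
qed

lemma Lam_E:
  assumes "\<phi> \<in> Lam n m"
  obtains f where "f \<in> cyc_maps n m" "\<phi> = cyc_class n m f"
  using assms unfolding Lam_def by (rule quotientE)

lemma cyc_class_in_Lam: "f \<in> cyc_maps n m \<Longrightarrow> cyc_class n m f \<in> Lam n m"
  unfolding Lam_def by (rule quotientI)

text \<open>All representatives yield the same class, so the union collapses to the value at
  \<open>f\<close>.\<close>

lemma Lam_t_class: "f \<in> cyc_maps n m \<Longrightarrow> Lam_t n m (cyc_class n m f) = cyc_class m n (cyc_t f)"
  unfolding Lam_t_def by (rule UN_equiv_class[OF equiv_cyc_rel cyc_t_respects])

lemma Lam_star_class: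
  "f \<in> cyc_maps n m \<Longrightarrow> Lam_star n m (cyc_class n m f) = cyc_class m n (cyc_star n m f)"
  unfolding Lam_star_def by (rule UN_equiv_class[OF equiv_cyc_rel cyc_star_respects])

lemma Lam_comp_class:
  "g \<in> cyc_maps m k \<Longrightarrow> f \<in> cyc_maps n m \<Longrightarrow>
    Lam_comp n m k (cyc_class m k g) (cyc_class n m f) = cyc_class n k (g \<circ> f)"
  unfolding Lam_comp_def
  by (rule UN_equiv_class2[OF equiv_cyc_rel equiv_cyc_rel comp_respects2])

text \<open>Besides bilinearity, the isomorphism and the two inverse identities, the conjuncts
  certify that \<open>Inf\<close>, \<open>THE\<close>, \<open>the\<close> and the unions over
  representatives are applied where they are meaningful, and that \<open>Lam_t\<close> is a
  contravariant functor.\<close>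

theorem proposition4p6:
  shows "
    (\<forall>A :: 'a ordset_aut. archimedean_set A \<longrightarrow>
       (\<forall>x\<in>carrier (vee A). \<forall>y\<in>carrier (vee A) - {zero (vee A)}.
          {v. vee_le A x (smult (vee A) v y)} \<noteq> {}) \<and>
       bilinear_map (vee A) (vee_dual A) zmax_semimod (pairing A))
  \<and>
    (\<forall>n::nat. n \<ge> 1 \<longrightarrow>
       (\<lambda>y\<in>carrier (vee_dual (zshift n)). \<lambda>x\<in>carrier (vee (zshift n)). pairing (zshift n) x y)
         \<in> Iso (vee_dual (zshift n)) (Hom_semimod (vee (zshift n)) zmax_semimod))
  \<and>
    (\<forall>n m::nat. n \<ge> 1 \<longrightarrow> m \<ge> 1 \<longrightarrow>
       (\<forall>f\<in>Hom (vee (zshift n)) (vee (zshift m)). \<exists>!g. is_transpose (zshift n) (zshift m) f g))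
  \<and>
    (\<forall>n m. \<forall>f\<in>cyc_maps n m.
       (\<exists>!g. is_cyc_t f g) \<and> cyc_t f \<in> cyc_maps m n \<and>
       Hom_transpose (zshift (n + 1)) (zshift (m + 1)) (map_option f) -` {None} = {None} \<and>
       cyc_star n m f \<in> cyc_maps m n)
  \<and>
    (\<forall>n m. (\<lambda>f. cyc_class m n (cyc_t f)) respects cyc_rel n m \<and>
            (\<lambda>f. cyc_class m n (cyc_star n m f)) respects cyc_rel n m)
  \<and>
    (\<forall>n. Lam_t n n (Lam_id n) = Lam_id n)
  \<and>
    (\<forall>n m k. \<forall>\<phi>\<in>Lam n m. \<forall>\<psi>\<in>Lam m k.
       Lam_t n k (Lam_comp n m k \<psi> \<phi>) = Lam_comp k m n (Lam_t n m \<phi>) (Lam_t m k \<psi>))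
  \<and>
    (\<forall>n m. \<forall>\<phi>\<in>Lam n m.
       Lam_t n m \<phi> \<in> Lam m n \<and> Lam_star n m \<phi> \<in> Lam m n \<and>
       Lam_star m n (Lam_t n m \<phi>) = \<phi> \<and> Lam_t m n (Lam_star n m \<phi>) = \<phi>)"
proof (intro conjI allI impI ballI)
  fix A :: "'a ordset_aut" assume A: "archimedean_set A"
  show "bilinear_map (vee A) (vee_dual A) zmax_semimod (pairing A)"
    by (rule bilinear_map_pairing[OF A])
  show "{v. vee_le A x (smult (vee A) v y)} \<noteq> {}"
    if "x \<in> carrier (vee A)" "y \<in> carrier (vee A) - {zero (vee A)}" for x y
    using ex_smult_ge[OF A that(1)] that(2) by (cases y) auto
next
  fix n m k and \<phi> \<psi> assume "\<phi> \<in> Lam n m" "\<psi> \<in> Lam m k"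
  then obtain f g where "f \<in> cyc_maps n m" "\<phi> = cyc_class n m f"
    "g \<in> cyc_maps m k" "\<psi> = cyc_class m k g" by (elim Lam_E)
  then show "Lam_t n k (Lam_comp n m k \<psi> \<phi>) = Lam_comp k m n (Lam_t n m \<phi>) (Lam_t m k \<psi>)"
    by (simp add: Lam_comp_class Lam_t_class cyc_t_comp cyc_t_in comp_in_cyc_maps)
next
  fix n m \<phi> assume "\<phi> \<in> Lam n m"
  then obtain f where f: "f \<in> cyc_maps n m" "\<phi> = cyc_class n m f" by (rule Lam_E)
  then show "Lam_t n m \<phi> \<in> Lam m n" "Lam_star n m \<phi> \<in> Lam m n"
    "Lam_star m n (Lam_t n m \<phi>) = \<phi>" "Lam_t m n (Lam_star n m \<phi>) = \<phi>"
    by (simp_all add: Lam_t_class Lam_star_class cyc_t_in cyc_star_in cyc_class_in_Lam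
        cyc_star_cyc_t cyc_t_cyc_star)
next
  fix n m f assume f: "f \<in> cyc_maps n m"
  show "\<exists>!g. is_cyc_t f g" using is_cyc_t_cyc_t[OF f] is_cyc_t_unique by blast
qed (simp_all add: Iso_pairing_zshift ex1_transpose_zshift cyc_t_in cyc_star_in
    Hom_transpose_zshift(1)[simplified] cyc_t_respects cyc_star_respects Lam_id_def Lam_t_class
    id_in_cyc_maps cyc_t_id del: zshift_simps)

end
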